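(* Let $m\ge 2$ and $\gamma\ge 1$ be integers, let $g$ be an integer, and let $T$ be a numerical semigroup of genus $\gamma$ and multiplicity $m$, written as $T = \langle m, me_1+1, me_2+2, \ldots, me_{m-1}+(m-1)\rangle$, where for each $i\in\{1,\dots,m-1\}$, $me_i+i=\min\{t\in T: t\equiv i \pmod m\}$. Then a numerical semigroup $S$ has genus $g$, exactly $\gamma$ even gaps, and satisfies $S/2 = T$ if and only if $$S = \langle 2m,\ 2me_1+2,\ \ldots,\ 2me_{m-1}+(2m-2),\ 2mk_1+1,\ 2mk_3+3,\ \ldots,\ 2mk_{2m-1}+(2m-1) \rangle,$$ where $(k_1,k_3,\ldots,k_{2m-1}) \in \mathbb{N}_0^{m}$ is a solution $(X_1,X_3,\dots,X_{2m-1})=(k_1,k_3,\dots,k_{2m-1})$ of the system $$ \begin{cases} X_{2i-1} + e_j \geq X_{2(i+j)-1}, & \text{for } 1 \leq i \leq m,\ 1 \leq j \leq m-1,\ i + j \leq m; \\ X_{2i-1} + e_j + 1 \geq X_{2(i+j-m)-1}, & \text{for } 1 \leq i \leq m,\ 1 \leq j \leq m-1,\ i + j > m; \\ X_{2i-1} + X_{2j-1} \geq e_{i+j-1}, & \text{for } 1 \leq i \leq j \leq m,\ i + j \leq m; \\ X_{2i-1} + X_{2j-1} + 1 \geq e_{i+j-1-m}, & \text{for } 1 \leq i \leq j \leq m,\ i + j \geq m+2; \\ \sum_{i=1}^{m} X_{2i-1} = g-\gamma. \end{cases} $$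
   Context: A numerical semigroup is a subset $S\subseteq\mathbb{N}_0$ with $0\in S$, closed under addition, and with finite complement $\mathbb{N}_0\setminus S$ (the set of gaps). The genus is the number of gaps and the multiplicity is the smallest nonzero element. $\langle a_1,\dots,a_r\rangle$ denotes the submonoid of $\mathbb{N}_0$ generated by $a_1,\dots,a_r$. For a numerical semigroup $S$, $S/2:=\{s\in\mathbb{N}_0 : 2s\in S\}$ (again a numerical semigroup, whose genus equals the number of even gaps of $S$). The paper denotes by $\mathcal S_\gamma(g)$ the set of numerical semigroups of genus $g$ with exactly $\gamma$ even gaps, by $\mathcal S_\gamma$ the set of numerical semigroups of genus $\gamma$, and by $\mathbf x_g:\mathcal S_\gamma(g)\to\mathcal S_\gamma$ the map $S\mapsto S/2$; the theorem characterizes the fiber $\mathbf x_g^{-1}(T)$. *)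

theory Defs
  imports Complex_Main "HOL-Number_Theory.Cong"
begin

definition add_submonoid :: "nat set \<Rightarrow> bool" where
  "add_submonoid A \<longleftrightarrow> 0 \<in> A \<and> (\<forall>x\<in>A. \<forall>y\<in>A. x + y \<in> A)"

definition generated :: "nat set \<Rightarrow> nat set" where
  "generated A = add_submonoid hull A"

definition gaps :: "nat set \<Rightarrow> nat set" where
  "gaps S = UNIV - S"

definition numerical_semigroup :: "nat set \<Rightarrow> bool" where
  "numerical_semigroup S \<longleftrightarrow> add_submonoid S \<and> finite (gaps S)"

definition genus :: "nat set \<Rightarrow> nat" where
  "genus S = card (gaps S)"

definition even_gaps :: "nat set \<Rightarrow> nat set" where
  "even_gaps S = {x \<in> gaps S. even x}"

definition semigroup_multiplicity :: "nat set \<Rightarrow> nat" where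
  "semigroup_multiplicity S = (LEAST s. s \<in> S \<and> s \<noteq> 0)"

definition half :: "nat set \<Rightarrow> nat set" where
  "half S = {s. 2 * s \<in> S}"

end

theory Submission
  imports Defs
begin

text \<open>
  A numerical semigroup \<open>S\<close> containing \<open>M > 0\<close> meets every residue class modulo \<open>M\<close> in a
  half-line. Taking \<open>M = 2m\<close> and \<open>S/2 = T\<close>, the even part of \<open>S\<close> is \<open>2T\<close>, and the odd part is
  determined by the starting points \<open>2m k\<^sub>r + r\<close> of the half-lines in the odd classes \<open>r\<close>.
  The inequalities of the system say precisely that such a union of half-lines is closed under
  addition: the first two cover odd plus even, the last two odd plus odd (the case
  \<open>i + j = m + 1\<close> is missing because a sum divisible by \<open>2m\<close> always lies in \<open>2T\<close>).
  Each odd class \<open>r\<close> contributes \<open>k\<^sub>r\<close> gaps, which gives the equation.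
\<close>

section \<open>Generated submonoids and residue classes\<close>

lemma add_submonoid_generated: "add_submonoid (generated A)"
  unfolding generated_def by (rule hull_in) (simp add: add_submonoid_def)

lemma generated_inc: "x \<in> A \<Longrightarrow> x \<in> generated A"
  unfolding generated_def by (rule hull_inc)

lemma generated_eqI:
  assumes "add_submonoid B" "A \<subseteq> B" "B \<subseteq> generated A"
  shows "generated A = B"
  using assms hull_minimal[of A B add_submonoid] unfolding generated_def by blast

lemma add_submonoid_add: "add_submonoid A \<Longrightarrow> x \<in> A \<Longrightarrow> y \<in> A \<Longrightarrow> x + y \<in> A"
  by (simp add: add_submonoid_def)

lemma add_submonoid_mult:
  fixes a :: nat
  assumes "add_submonoid A" "a \<in> A"
  shows "a * x \<in> A"
  using assms by (induction x) (auto simp: add_submonoid_def)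

text \<open>Adding \<open>M\<close> preserves membership, so each class meets \<open>S\<close> in an
  upward closed set. That set is nonempty, since otherwise the injective map
  \<open>x \<mapsto> M * x + r\<close> would produce infinitely many gaps; its least element is
  \<open>q\<close>.\<close>

lemma numerical_semigroup_residue_class:
  assumes S: "numerical_semigroup S" and M: "M \<in> S" "M > 0"
  obtains q where "\<And>x. M * x + r \<in> S \<longleftrightarrow> q \<le> x"
proof -
  have sub: "add_submonoid S" and fin: "finite (gaps S)"
    using S by (auto simp: numerical_semigroup_def)
  have "\<exists>x. M * x + r \<in> S"
  proof (rule ccontr)
    assume "\<not> ?thesis"
    then have "range (\<lambda>x. M * x + r) \<subseteq> gaps S" by (auto simp: gaps_def)
    moreover have "inj (\<lambda>x. M * x + r)" using M by (auto simp: inj_def)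
    ultimately show False
      using fin finite_subset finite_imageD infinite_UNIV_nat by blast
  qed
  then have least: "M * (LEAST x. M * x + r \<in> S) + r \<in> S" (is "M * ?q + r \<in> S")
    by (rule LeastI_ex)
  have "M * x + r \<in> S" if le: "?q \<le> x" for x
  proof -
    obtain d where "x = ?q + d" using le_Suc_ex[OF le] by blast
    then have "M * x + r = (M * ?q + r) + M * d" by (simp only: add_mult_distrib2 ac_simps)
    then show ?thesis
      using add_submonoid_add[OF sub least add_submonoid_mult[OF sub M(1), of d]] by (simp only:)
  qed
  then show ?thesis
    using that[of ?q] Least_le[of "\<lambda>x. M * x + r \<in> S"] by blast
qed

text \<open>For \<open>i\<close> in \<open>{1..m}\<close> the numbers \<open>2*i-1\<close> are odd
  remainders below \<open>2*m\<close>, so this is uniqueness of division with remainder.\<close>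

lemma odd_residue_unique:
  fixes m :: nat
  assumes "i \<in> {1..m}" "j \<in> {1..m}" "2 * m * x + (2*i-1) = 2 * m * y + (2*j-1)"
  shows "i = j \<and> x = y"
proof -
  have lt: "2*i-1 < 2*m" "2*j-1 < 2*m" using assms by auto
  have "(2 * m * x + (2*i-1)) mod (2*m) = 2*i-1" "(2 * m * y + (2*j-1)) mod (2*m) = 2*j-1"
    using lt by simp_all
  then have "2*i-1 = 2*j-1" using assms(3) by metis
  moreover from this have "2 * m * x = 2 * m * y" using assms(3) by (metis add_right_cancel)
  ultimately show ?thesis using assms(1,2) by auto
qed

text \<open>The existence counterpart: the modulus \<open>2*m\<close> is even, so an odd number
  leaves an odd remainder.\<close>

lemma odd_residue_cases:
  fixes m :: nat
  assumes "odd n" "m > 0"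
  obtains i x where "i \<in> {1..m}" "n = 2 * m * x + (2*i-1)"
proof -
  have "odd (n mod (2*m))" using assms(1) by (simp add: dvd_mod_iff)
  then obtain c where c: "n mod (2*m) = 2*c + 1" by (rule oddE)
  have "n mod (2*m) < 2*m" using assms(2) by simp
  then have "Suc c \<in> {1..m}" using c by auto
  moreover have "n = 2 * m * (n div (2*m)) + (2 * Suc c - 1)"
    using c mult_div_mod_eq[of "2*m" n] by simp
  ultimately show ?thesis by (rule that)
qed

section \<open>Kunz coordinates \<open>e\<close> of \<open>T\<close>, and sets lifted from
  \<open>T\<close> by odd coordinates \<open>k\<close>\<close>

locale apery_coordinates =
  fixes T :: "nat set" and m :: nat and e :: "nat \<Rightarrow> nat"
  assumes m_pos: "m > 0"
    and submonoid: "add_submonoid T"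
    and m_mem: "m \<in> T"
    and mem_iff: "\<And>j x. j \<in> {1..m-1} \<Longrightarrow> m * x + j \<in> T \<longleftrightarrow> e j \<le> x"
begin

definition odd_part :: "(nat \<Rightarrow> nat) \<Rightarrow> nat set" where
  "odd_part k = {2 * m * x + (2*i-1) | i x. i \<in> {1..m} \<and> k (2*i-1) \<le> x}"

text \<open>Defined for arbitrary \<open>k\<close>, so that closure under addition becomes a
  condition on \<open>k\<close>. Only the values of \<open>k\<close> at odd arguments below
  \<open>2*m\<close> matter.\<close>

definition lift :: "(nat \<Rightarrow> nat) \<Rightarrow> nat set" where
  "lift k = (*) 2 ` T \<union> odd_part k"

definition lift_generators :: "(nat \<Rightarrow> nat) \<Rightarrow> nat set" where
  "lift_generators k = {2 * m} \<union> {2 * m * e i + 2 * i | i. i \<in> {1..m-1}}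
     \<union> {2 * m * k (2*i-1) + (2*i-1) | i. i \<in> {1..m}}"

definition odd_even_closed :: "(nat \<Rightarrow> nat) \<Rightarrow> bool" where
  "odd_even_closed k \<longleftrightarrow>
     (\<forall>i\<in>{1..m}. \<forall>j\<in>{1..m-1}. i + j \<le> m \<longrightarrow> k (2*i-1) + e j \<ge> k (2*(i+j)-1)) \<and>
     (\<forall>i\<in>{1..m}. \<forall>j\<in>{1..m-1}. i + j > m \<longrightarrow> k (2*i-1) + e j + 1 \<ge> k (2*(i+j-m)-1))"

text \<open>Restricting to \<open>i \<le> j\<close> loses nothing because addition is commutative.
  The \<open>+ 1\<close> in the second clause is the carry when the residue \<open>i+j-1\<close>
  exceeds \<open>m\<close>.\<close>

definition odd_odd_closed :: "(nat \<Rightarrow> nat) \<Rightarrow> bool" where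
  "odd_odd_closed k \<longleftrightarrow>
     (\<forall>i\<in>{1..m}. \<forall>j\<in>{i..m}. i + j \<le> m \<longrightarrow> k (2*i-1) + k (2*j-1) \<ge> e (i+j-1)) \<and>
     (\<forall>i\<in>{1..m}. \<forall>j\<in>{i..m}. i + j \<ge> m + 2 \<longrightarrow> k (2*i-1) + k (2*j-1) + 1 \<ge> e (i+j-1-m))"

section \<open>Membership and generators of the lifted set\<close>

lemma mult_mem: "m * x \<in> T"
  using submonoid m_mem by (rule add_submonoid_mult)

lemma mem_cases:
  assumes "t \<in> T"
  obtains x where "t = m * x"
  | j x where "j \<in> {1..m-1}" "e j \<le> x" "t = m * x + j"
proof (cases "t mod m = 0")
  case True
  then show ?thesis using that(1) by auto
next
  case False
  have "t mod m < m" using m_pos by simp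
  then have j: "t mod m \<in> {1..m-1}" using False by auto
  have t: "t = m * (t div m) + t mod m" by simp
  then show ?thesis using that(2)[OF j _ t] mem_iff[OF j] assms by metis
qed

lemma odd_part_odd: "n \<in> odd_part k \<Longrightarrow> odd n"
  by (auto simp: odd_part_def)

lemma odd_part_generator: "i \<in> {1..m} \<Longrightarrow> 2 * m * k (2*i-1) + (2*i-1) \<in> odd_part k"
  unfolding odd_part_def by blast

lemma even_mem_lift_iff: "2 * t \<in> lift k \<longleftrightarrow> t \<in> T"
  using odd_part_odd[of "2 * t" k] by (auto simp: lift_def)

lemma odd_mem_lift_iff:
  assumes "i \<in> {1..m}"
  shows "2 * m * x + (2*i-1) \<in> lift k \<longleftrightarrow> k (2*i-1) \<le> x"
proof -
  have "odd (2 * m * x + (2*i-1))" using assms by simp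
  then have "2 * m * x + (2*i-1) \<notin> (*) 2 ` T" by (metis dvd_triv_left imageE)
  then show ?thesis
    using assms odd_residue_unique[OF assms] unfolding lift_def odd_part_def by blast
qed

lemma lift_generators_subset: "lift_generators k \<subseteq> lift k"
proof -
  have "2 * m \<in> lift k" by (simp add: even_mem_lift_iff m_mem)
  moreover have "2 * m * e i + 2 * i \<in> lift k" if "i \<in> {1..m-1}" for i
    using even_mem_lift_iff[of "m * e i + i" k] mem_iff[OF that, of "e i"]
    by (simp add: algebra_simps)
  moreover have "2 * m * k (2*i-1) + (2*i-1) \<in> lift k" if "i \<in> {1..m}" for i
    using odd_mem_lift_iff[OF that] by simp
  ultimately show ?thesis unfolding lift_generators_def by blast
qed

text \<open>Every half-line is reached from its starting generator by adding multiples of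
  \<open>2 * m\<close>. This holds for every \<open>k\<close>; closure of \<open>lift k\<close>
  enters only for the reverse inclusion.\<close>

lemma lift_subset_generated: "lift k \<subseteq> generated (lift_generators k)" (is "_ \<subseteq> ?G")
proof
  fix n assume n: "n \<in> lift k"
  note G = add_submonoid_generated[of "lift_generators k"]
  have "2 * m \<in> ?G" by (rule generated_inc) (simp add: lift_generators_def)
  then have mult: "2 * m * x \<in> ?G" for x by (rule add_submonoid_mult[OF G])
  have shift: "2 * m * x + r \<in> ?G" if start: "2 * m * q + r \<in> ?G" and le: "q \<le> x" for q x r
  proof -
    obtain d where "x = q + d" using le_Suc_ex[OF le] by blast
    then have "2 * m * x + r = (2 * m * q + r) + 2 * m * d"
      by (simp add: add_mult_distrib2)
    then show ?thesis using add_submonoid_add[OF G start mult[of d]] by (simp only:)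
  qed
  consider t where "t \<in> T" "n = 2 * t" | "n \<in> odd_part k"
    using n by (auto simp: lift_def)
  then show "n \<in> ?G"
  proof cases
    case 1
    from 1(1) show ?thesis
    proof (cases rule: mem_cases)
      case (1 x)
      then show ?thesis using mult[of x] \<open>n = 2 * t\<close> by (simp add: mult.assoc)
    next
      case (2 j x)
      have "2 * m * e j + 2 * j \<in> ?G"
        by (rule generated_inc) (use 2 in \<open>auto simp: lift_generators_def\<close>)
      from shift[OF this 2(2)] show ?thesis
        using 2 \<open>n = 2 * t\<close> by (simp add: algebra_simps)
    qed
  next
    case 2
    then obtain i x where i: "i \<in> {1..m}" "k (2*i-1) \<le> x" "n = 2 * m * x + (2*i-1)"
      by (auto simp: odd_part_def)
    have "2 * m * k (2*i-1) + (2*i-1) \<in> ?G"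
      by (rule generated_inc) (use i in \<open>auto simp: lift_generators_def\<close>)
    from shift[OF this i(2)] show ?thesis using i by simp
  qed
qed

lemma generated_lift_generators:
  "add_submonoid (lift k) \<Longrightarrow> generated (lift_generators k) = lift k"
  by (intro generated_eqI lift_generators_subset lift_subset_generated)

text \<open>Adding \<open>2*j\<close> to the residue \<open>2*i-1\<close> stays below
  \<open>2*m\<close> exactly when \<open>i + j \<le> m\<close>; otherwise a carry raises the
  coordinate by one. Since the coordinates add, it suffices to compare the starting points of the
  half-lines.\<close>

lemma odd_even_closed_iff:
  "odd_even_closed k \<longleftrightarrow> (\<forall>n\<in>odd_part k. \<forall>t\<in>T. n + 2 * t \<in> lift k)"
proof -
  have sum: "2 * m * x + (2*i-1) + 2 * (m * y + j) \<in> lift k \<longleftrightarrow>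
      (if i + j \<le> m then k (2*(i+j)-1) \<le> x + y else k (2*(i+j-m)-1) \<le> x + y + 1)"
    if "i \<in> {1..m}" "j \<le> m - 1" for i j x y
  proof (cases "i + j \<le> m")
    case True
    have "2 * m * x + (2*i-1) + 2 * (m * y + j) = 2 * m * (x + y) + (2*(i+j)-1)"
      using that by (simp add: algebra_simps)
    then show ?thesis using True that odd_mem_lift_iff[of "i+j" "x+y" k] by auto
  next
    case False
    have "2*i-1 + 2*j = 2*m + (2*(i+j-m)-1)" using False that by auto
    then have "2 * m * x + (2*i-1) + 2 * (m * y + j) = 2 * m * (x + y + 1) + (2*(i+j-m)-1)"
      by (simp add: algebra_simps)
    moreover have "i + j - m \<in> {1..m}" using False that by auto
    ultimately show ?thesis using False odd_mem_lift_iff[of "i+j-m" "x+y+1" k] by auto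
  qed
  show ?thesis
  proof
    assume cl: "odd_even_closed k"
    show "\<forall>n\<in>odd_part k. \<forall>t\<in>T. n + 2 * t \<in> lift k"
    proof (intro ballI)
      fix n t assume "n \<in> odd_part k" "t \<in> T"
      then obtain i x where i: "i \<in> {1..m}" "k (2*i-1) \<le> x" "n = 2 * m * x + (2*i-1)"
        by (auto simp: odd_part_def)
      from \<open>t \<in> T\<close> show "n + 2 * t \<in> lift k"
      proof (cases rule: mem_cases)
        case (1 y)
        then show ?thesis using sum[OF i(1), of 0 x y] i by simp
      next
        case (2 j y)
        show ?thesis
        proof (cases "i + j \<le> m")
          case True
          have "k (2*(i+j)-1) \<le> k (2*i-1) + e j"
            using cl i 2 True unfolding odd_even_closed_def by blast
          then show ?thesis using sum[OF i(1), of j x y] i 2 True by auto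
        next
          case False
          then have "k (2*(i+j-m)-1) \<le> k (2*i-1) + e j + 1"
            using cl i 2 unfolding odd_even_closed_def by auto
          then show ?thesis using sum[OF i(1), of j x y] i 2 False by auto
        qed
      qed
    qed
  next
    assume cl: "\<forall>n\<in>odd_part k. \<forall>t\<in>T. n + 2 * t \<in> lift k"
    have "if i + j \<le> m then k (2*(i+j)-1) \<le> k (2*i-1) + e j
        else k (2*(i+j-m)-1) \<le> k (2*i-1) + e j + 1" if "i \<in> {1..m}" "j \<in> {1..m-1}" for i j
    proof -
      \<comment> \<open>Closure tested on the two starting points is exactly the required
        inequality.\<close>
      have "2 * m * k (2*i-1) + (2*i-1) \<in> odd_part k"
        using that(1) by (rule odd_part_generator)
      moreover have "m * e j + j \<in> T" using mem_iff that by simp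
      ultimately show ?thesis using cl sum that by (metis atLeastAtMost_iff)
    qed
    then show "odd_even_closed k" unfolding odd_even_closed_def
      by (metis not_le)
  qed
qed

text \<open>The residues \<open>2*i-1\<close> and \<open>2*j-1\<close> add up to
  \<open>2*(i+j-1)\<close>, so membership of the sum is decided in \<open>T\<close>, at the residue
  of \<open>i+j-1\<close> modulo \<open>m\<close>.\<close>

lemma odd_odd_closed_iff:
  "odd_odd_closed k \<longleftrightarrow> (\<forall>n\<in>odd_part k. \<forall>n'\<in>odd_part k. n + n' \<in> lift k)"
proof -
  have sum: "2 * m * x + (2*i-1) + (2 * m * y + (2*j-1)) \<in> lift k \<longleftrightarrow>
      (i + j \<le> m \<longrightarrow> e (i+j-1) \<le> x + y) \<and> (i + j \<ge> m + 2 \<longrightarrow> e (i+j-1-m) \<le> x + y + 1)"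
    if "i \<in> {1..m}" "j \<in> {1..m}" for i j x y
  proof -
    have eq: "2 * m * x + (2*i-1) + (2 * m * y + (2*j-1)) = 2 * (m * (x + y) + (i + j - 1))"
      using that by (simp add: algebra_simps)
    consider "i + j \<le> m" | "i + j = m + 1" | "i + j \<ge> m + 2" by linarith
    then show ?thesis
    proof cases
      case 1
      then have "i + j - 1 \<in> {1..m-1}" using that by auto
      from mem_iff[OF this, of "x + y"] show ?thesis
        unfolding eq even_mem_lift_iff using 1 by simp
    next
      case 2
      then have "m * (x + y) + (i + j - 1) = m * (x + y + 1)" by simp
      then show ?thesis using 2 unfolding eq even_mem_lift_iff by (simp only: mult_mem) simp
    next
      case 3
      then have "m * (x + y) + (i + j - 1) = m * (x + y + 1) + (i + j - 1 - m)"
        by simp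
      moreover have "i + j - 1 - m \<in> {1..m-1}" using 3 that by auto
      note mem_iff[OF this, of "x + y + 1"]
      ultimately show ?thesis
        unfolding eq even_mem_lift_iff using 3 by (simp only:) simp
    qed
  qed
  show ?thesis
  proof
    assume cl: "odd_odd_closed k"
    have le: "2 * m * x + (2*i-1) + (2 * m * y + (2*j-1)) \<in> lift k"
      if "i \<in> {1..m}" "j \<in> {i..m}" "k (2*i-1) \<le> x" "k (2*j-1) \<le> y" for i j x y
    proof -
      have "i + j \<le> m \<longrightarrow> e (i+j-1) \<le> k (2*i-1) + k (2*j-1)"
        "i + j \<ge> m + 2 \<longrightarrow> e (i+j-1-m) \<le> k (2*i-1) + k (2*j-1) + 1"
        using cl that(1,2) unfolding odd_odd_closed_def by blast+
      then show ?thesis using sum[of i j x y] that by auto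
    qed
    show "\<forall>n\<in>odd_part k. \<forall>n'\<in>odd_part k. n + n' \<in> lift k"
    proof (intro ballI)
      fix n n' assume "n \<in> odd_part k" "n' \<in> odd_part k"
      then obtain i x j y where ij:
        "i \<in> {1..m}" "k (2*i-1) \<le> x" "n = 2 * m * x + (2*i-1)"
        "j \<in> {1..m}" "k (2*j-1) \<le> y" "n' = 2 * m * y + (2*j-1)"
        by (auto simp: odd_part_def)
      show "n + n' \<in> lift k"
      proof (cases "i \<le> j")
        case True
        then show ?thesis using le[of i j x y] ij by auto
      next
        case False
        then show ?thesis using le[of j i y x] ij by (auto simp: add.commute)
      qed
    qed
  next
    assume cl: "\<forall>n\<in>odd_part k. \<forall>n'\<in>odd_part k. n + n' \<in> lift k"
    have "(i + j \<le> m \<longrightarrow> e (i+j-1) \<le> k (2*i-1) + k (2*j-1)) \<and>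
        (i + j \<ge> m + 2 \<longrightarrow> e (i+j-1-m) \<le> k (2*i-1) + k (2*j-1) + 1)"
      if "i \<in> {1..m}" "j \<in> {1..m}" for i j
      using that[THEN odd_part_generator] that cl sum by blast
    then show "odd_odd_closed k" unfolding odd_odd_closed_def by auto
  qed
qed

text \<open>Sums of two even elements are covered by closure of \<open>T\<close>; the two predicates
  account for the remaining parity combinations.\<close>

lemma add_submonoid_lift_iff:
  "add_submonoid (lift k) \<longleftrightarrow> odd_even_closed k \<and> odd_odd_closed k"
proof -
  have even: "2 * s + 2 * t \<in> lift k" if "s \<in> T" "t \<in> T" for s t
    using add_submonoid_add[OF submonoid that] even_mem_lift_iff[of "s + t" k] by simp
  have zero: "0 \<in> lift k"
    using submonoid even_mem_lift_iff[of 0 k] by (simp add: add_submonoid_def)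
  show ?thesis (is "_ \<longleftrightarrow> ?R")
  proof
    assume "add_submonoid (lift k)"
    then have "x + y \<in> lift k" if "x \<in> lift k" "y \<in> lift k" for x y
      using that by (rule add_submonoid_add)
    then show ?R
      unfolding odd_even_closed_iff odd_odd_closed_iff by (simp add: lift_def)
  next
    assume R: ?R
    then have odd_even: "n + 2 * t \<in> lift k" if "n \<in> odd_part k" "t \<in> T" for n t
      using that by (simp add: odd_even_closed_iff)
    then have even_odd: "2 * t + n \<in> lift k" if "n \<in> odd_part k" "t \<in> T" for n t
      using that by (metis add.commute)
    have odd_odd: "n + n' \<in> lift k" if "n \<in> odd_part k" "n' \<in> odd_part k" for n n'
      using R that by (simp add: odd_odd_closed_iff)
    have "x + y \<in> lift k" if "x \<in> (*) 2 ` T \<union> odd_part k" "y \<in> (*) 2 ` T \<union> odd_part k" for x y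
      using that even odd_even even_odd odd_odd by blast
    then show "add_submonoid (lift k)"
      using zero by (simp add: add_submonoid_def lift_def)
  qed
qed

section \<open>Half, even gaps and genus of the lifted set\<close>

lemma half_lift: "half (lift k) = T"
  by (auto simp: half_def even_mem_lift_iff)

lemma even_gaps_lift: "even_gaps (lift k) = (*) 2 ` gaps T"
  by (auto simp: even_gaps_def gaps_def even_mem_lift_iff elim!: evenE)

lemma card_even_gaps_lift: "card (even_gaps (lift k)) = genus T"
  unfolding even_gaps_lift genus_def by (rule card_image) (simp add: inj_on_def)

lemma genus_lift:
  assumes "finite (gaps T)"
  shows "genus (lift k) = genus T + (\<Sum>i=1..m. k (2*i-1))"
proof -
  \<comment> \<open>\<open>U\<close> collects the points below the start of each odd half-line;
    these turn out to be the odd gaps.\<close>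
  define U where "U = (\<Union>i\<in>{1..m}. (\<lambda>x. 2 * m * x + (2*i-1)) ` {..<k (2*i-1)})"
  have gap: "n \<in> gaps (lift k) \<longleftrightarrow> n \<in> U" if n: "odd n" for n
  proof -
    obtain i x where i: "i \<in> {1..m}" "n = 2 * m * x + (2*i-1)"
      using odd_residue_cases[OF n m_pos] .
    have "n \<in> gaps (lift k) \<longleftrightarrow> x < k (2*i-1)"
      using odd_mem_lift_iff[OF i(1)] i by (auto simp: gaps_def)
    also have "\<dots> \<longleftrightarrow> n \<in> U"
    proof
      assume "x < k (2*i-1)"
      then show "n \<in> U" unfolding U_def using i by blast
    next
      assume "n \<in> U"
      then obtain j y where "j \<in> {1..m}" "y < k (2*j-1)" "n = 2 * m * y + (2*j-1)"
        unfolding U_def by blast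
      then show "x < k (2*i-1)" using odd_residue_unique[OF i(1), of j x y] i(2) by simp
    qed
    finally show ?thesis .
  qed
  have odd: "odd n" if "n \<in> U" for n using that by (auto simp: U_def)
  have "gaps (lift k) = even_gaps (lift k) \<union> U"
    using gap odd by (auto simp: even_gaps_def)
  moreover have "even_gaps (lift k) \<inter> U = {}" using odd by (auto simp: even_gaps_def)
  moreover have "finite (even_gaps (lift k))" using assms by (simp add: even_gaps_lift)
  moreover have "finite U" by (simp add: U_def)
  ultimately have "genus (lift k) = card (even_gaps (lift k)) + card U"
    unfolding genus_def by (simp add: card_Un_disjoint)
  also have "card U = (\<Sum>i=1..m. card ((\<lambda>x. 2 * m * x + (2*i-1)) ` {..<k (2*i-1)}))"
    unfolding U_def
  proof (rule card_UN_disjoint, safe)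
    \<comment> \<open>After \<open>safe\<close>, disjointness of the images for distinct
      \<open>i\<close> and \<open>j\<close> appears as membership in \<open>{}\<close>, proved by
      contradiction.\<close>
    fix i j x y
    assume "i \<in> {1..m}" "j \<in> {1..m}" "i \<noteq> j" "2 * m * x + (2*i-1) = 2 * m * y + (2*j-1)"
    then show "2 * m * x + (2*i-1) \<in> {}" using odd_residue_unique by blast
  qed auto
  also have "\<dots> = (\<Sum>i=1..m. k (2*i-1))"
  proof (rule sum.cong[OF refl])
    fix i assume "i \<in> {1..m}"
    then have "inj_on (\<lambda>x. 2 * m * x + (2*i-1)) {..<k (2*i-1)}"
      using odd_residue_unique by (intro inj_onI) blast
    then show "card ((\<lambda>x. 2 * m * x + (2*i-1)) ` {..<k (2*i-1)}) = k (2*i-1)"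
      by (simp only: card_image card_lessThan)
  qed
  finally show ?thesis by (simp add: card_even_gaps_lift)
qed

text \<open>The condition on \<open>half S\<close> fixes the even elements and puts
  \<open>2 * m\<close> into \<open>S\<close>, so the half-line description applies to the odd
  classes modulo \<open>2 * m\<close>.\<close>

lemma semigroup_eq_lift:
  assumes S: "numerical_semigroup S" and half: "half S = T"
  obtains k where "S = lift k"
proof -
  have even: "2 * t \<in> S \<longleftrightarrow> t \<in> T" for t using half by (auto simp: half_def)
  then have "2 * m \<in> S" "2 * m > 0" using m_mem m_pos by auto
  then have "\<exists>q. \<forall>x. 2 * m * x + r \<in> S \<longleftrightarrow> q \<le> x" for r
    using numerical_semigroup_residue_class[OF S, of "2 * m" r] by metis
  \<comment> \<open>Choice over all \<open>r\<close> gives one function \<open>k\<close>; its values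
    at odd residues are the wanted coordinates.\<close>
  then obtain k where k: "\<And>r x. 2 * m * x + r \<in> S \<longleftrightarrow> k r \<le> x" by metis
  have "n \<in> S \<longleftrightarrow> n \<in> lift k" for n
  proof (cases "even n")
    case True
    then show ?thesis using even even_mem_lift_iff by (metis evenE)
  next
    case False
    then obtain i x where "i \<in> {1..m}" "n = 2 * m * x + (2*i-1)"
      using odd_residue_cases m_pos by blast
    then show ?thesis using k odd_mem_lift_iff by (simp only:)
  qed
  then show ?thesis using that by blast
qed

end

text \<open>The least element of \<open>T\<close> in the class of \<open>j\<close> is the starting
  point \<open>m * q + j\<close> of its half-line, which forces \<open>e j = q\<close>.\<close>

lemma apery_coordinates_Least:
  assumes T: "numerical_semigroup T" and m: "m \<in> T" "m > 0"
    and e: "\<forall>i\<in>{1..m-1}. m * e i + i = (LEAST t. t \<in> T \<and> [t = i] (mod m))"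
  shows "apery_coordinates T m e"
proof
  show "add_submonoid T" using T by (simp add: numerical_semigroup_def)
  fix j x assume j: "j \<in> {1..m-1}"
  obtain q where q: "\<And>x. m * x + j \<in> T \<longleftrightarrow> q \<le> x"
    using numerical_semigroup_residue_class[OF T m, of j] by blast
  have "(LEAST t. t \<in> T \<and> [t = j] (mod m)) = m * q + j"
  proof (rule Least_equality)
    show "m * q + j \<in> T \<and> [m * q + j = j] (mod m)" using q by (simp add: cong_def)
    fix t assume t: "t \<in> T \<and> [t = j] (mod m)"
    then have "t mod m = j" using j m by (auto simp: cong_def)
    then have "t = m * (t div m) + j" using mult_div_mod_eq[of m t] by simp
    then show "m * q + j \<le> t" using q[of "t div m"] t by (metis add_le_mono1 mult_le_mono2)
  qed
  moreover have "m * e j + j = (LEAST t. t \<in> T \<and> [t = j] (mod m))" using e j by blast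
  ultimately have "e j = q" using m by simp
  then show "m * x + j \<in> T \<longleftrightarrow> e j \<le> x" using q by simp
qed (use m in auto)

theorem theorem3p3:
  fixes m \<gamma> :: nat and g :: int and T S :: "nat set" and e :: "nat \<Rightarrow> nat"
  assumes "m \<ge> 2" and "\<gamma> \<ge> 1"
    and "numerical_semigroup T" and "genus T = \<gamma>" and "semigroup_multiplicity T = m"
    and "\<forall>i\<in>{1..m-1}. m * e i + i = (LEAST t. t \<in> T \<and> [t = i] (mod m))"
    and "T = generated ({m} \<union> {m * e i + i | i. i \<in> {1..m-1}})"
    and "numerical_semigroup S"
  shows "int (genus S) = g \<and> card (even_gaps S) = \<gamma> \<and> half S = T \<longleftrightarrow>
    (\<exists>k :: nat \<Rightarrow> nat.
      S = generated ({2 * m} \<union> {2 * m * e i + 2 * i | i. i \<in> {1..m-1}}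
                       \<union> {2 * m * k (2*i-1) + (2*i-1) | i. i \<in> {1..m}}) \<and>
      (\<forall>i\<in>{1..m}. \<forall>j\<in>{1..m-1}. i + j \<le> m \<longrightarrow>
         k (2*i-1) + e j \<ge> k (2*(i+j)-1)) \<and>
      (\<forall>i\<in>{1..m}. \<forall>j\<in>{1..m-1}. i + j > m \<longrightarrow>
         k (2*i-1) + e j + 1 \<ge> k (2*(i+j-m)-1)) \<and>
      (\<forall>i\<in>{1..m}. \<forall>j\<in>{i..m}. i + j \<le> m \<longrightarrow>
         k (2*i-1) + k (2*j-1) \<ge> e (i+j-1)) \<and>
      (\<forall>i\<in>{1..m}. \<forall>j\<in>{i..m}. i + j \<ge> m + 2 \<longrightarrow>
         k (2*i-1) + k (2*j-1) + 1 \<ge> e (i+j-1-m)) \<and>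
      (\<Sum>i=1..m. int (k (2*i-1))) = g - int \<gamma>)"
proof -
  have "m \<in> T" by (subst assms(7)) (rule generated_inc, simp)
  then interpret apery_coordinates T m e
    using assms(1,3,6) by (intro apery_coordinates_Least) auto
  have fin: "finite (gaps T)" using assms(3) by (simp add: numerical_semigroup_def)
  \<comment> \<open>The inequalities of the system are folded into the two closure predicates and
    unfolded again at the end.\<close>
  have "int (genus S) = g \<and> card (even_gaps S) = \<gamma> \<and> half S = T \<longleftrightarrow>
    (\<exists>k. S = generated (lift_generators k) \<and> odd_even_closed k \<and> odd_odd_closed k \<and>
      (\<Sum>i=1..m. int (k (2*i-1))) = g - int \<gamma>)" (is "?L \<longleftrightarrow> ?R")
  proof
    assume L: ?L
    then obtain k where k: "S = lift k" using semigroup_eq_lift assms(8) by blast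
    have sub: "add_submonoid (lift k)" using assms(8) k by (simp add: numerical_semigroup_def)
    then have "S = generated (lift_generators k)" using k generated_lift_generators by simp
    moreover have "odd_even_closed k \<and> odd_odd_closed k" using sub add_submonoid_lift_iff by simp
    moreover have "(\<Sum>i=1..m. int (k (2*i-1))) = g - int \<gamma>"
      using L k genus_lift[OF fin, of k] assms(4) by auto
    ultimately show ?R by blast
  next
    assume ?R
    then obtain k where k: "S = generated (lift_generators k)"
      "odd_even_closed k" "odd_odd_closed k" "(\<Sum>i=1..m. int (k (2*i-1))) = g - int \<gamma>" by blast
    \<comment> \<open>The inequalities make \<open>lift k\<close> a submonoid, so the generators
      produce nothing beyond it.\<close>
    then have "S = lift k" using generated_lift_generators add_submonoid_lift_iff by simp
    then show ?L
      using k(4) genus_lift[OF fin, of k] card_even_gaps_lift half_lift assms(4) by auto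
  qed
  then show ?thesis
    unfolding lift_generators_def odd_even_closed_def odd_odd_closed_def by (simp only: conj_assoc)
qed

end
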